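(* Any streaming algorithm for \textsc{Connectivity} in the AL model that works on a family of graphs including all graphs of maximum degree $2$ and uses one pass over the stream requires $\Omega(n\log n)$ bits of memory on $n$-vertex graphs.
   Context: \textsc{Connectivity}: decide whether the graph is connected. In the Adjacency List (AL) streaming model the graph arrives as a sequence of vertices in arbitrary fixed order, each with the full list of its incident edges (each edge appears twice). Memory is measured in bits. "Requires $\Omega(f)$ bits" means there is a constant $c>0$ such that every such one-pass algorithm uses at least $cf$ bits on some $n$-vertex input of the class, for all sufficiently large $n$. *)

theory Defs
  imports "HOL-Probability.Probability_Mass_Function" "Graph_Theory.Graph_Theory"
begin

text \<open>
  A simple graph is a loop-free symmetric digraph: the edge \<open>{u, v}\<close> is the pair of arcs
  \<open>(u, v)\<close>, \<open>(v, u)\<close>, so the degree of a vertex is its out-degree.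
  An \<open>n\<close>-vertex graph has vertex set \<open>{0, ..., n - 1}\<close>, and graphs are nonempty.
\<close>

definition labelled_graph :: "nat pair_pre_digraph \<Rightarrow> bool" where
  "labelled_graph G \<longleftrightarrow> pair_graph G \<and> (\<exists>n>0. pverts G = {..<n})"

definition num_verts :: "nat pair_pre_digraph \<Rightarrow> nat" where
  "num_verts G = card (pverts G)"

definition max_degree :: "nat pair_pre_digraph \<Rightarrow> nat" where
  "max_degree G = Max (out_degree (with_proj G) ` pverts G)"

text \<open>
  The name \<open>connected\<close> also denotes topological connectedness in the imported libraries.
\<close>

definition graph_connected :: "nat pair_pre_digraph \<Rightarrow> bool" where
  "graph_connected G \<longleftrightarrow> Digraph_Component.connected (with_proj G)"

text \<open>
  An adjacency list stream: every vertex occurs exactly once, in any order, together with a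
  list of all its neighbours, again in any order.
\<close>

type_synonym al_token = "nat \<times> nat list"

definition al_stream :: "nat pair_pre_digraph \<Rightarrow> al_token list \<Rightarrow> bool" where
  "al_stream G xs \<longleftrightarrow>
     distinct (map fst xs) \<and> set (map fst xs) = pverts G \<and>
     (\<forall>(v, ns)\<in>set xs. distinct ns \<and> set ns = {w. (v, w) \<in> parcs G})"

text \<open>
  A deterministic one-pass algorithm for a decision problem. The bit string is all that is
  kept from one vertex of the stream to the next. Workspace used while a single adjacency
  list is being processed is not charged, which can only favour the algorithm.
\<close>

record stream_alg =
  init_mem :: "bool list"
  update_mem :: "bool list \<Rightarrow> al_token \<Rightarrow> bool list"
  answer :: "bool list \<Rightarrow> bool"

definition run :: "stream_alg \<Rightarrow> al_token list \<Rightarrow> bool list" where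
  "run A xs = foldl (update_mem A) (init_mem A) xs"

definition decision :: "stream_alg \<Rightarrow> al_token list \<Rightarrow> bool" where
  "decision A xs = answer A (run A xs)"

definition memory_bits :: "stream_alg \<Rightarrow> al_token list \<Rightarrow> nat" where
  "memory_bits A xs = Max ((\<lambda>i. length (run A (take i xs))) ` {..length xs})"

text \<open>
  A randomised algorithm is a distribution over deterministic ones (the coins are tossed in
  advance and are not charged as memory). The number of vertices is known beforehand: \<open>A n\<close>
  is what is run on \<open>n\<close>-vertex graphs. Success probability 2/3 is required on every
  stream of every graph of the family.
\<close>

type_synonym streaming_algorithm = "nat \<Rightarrow> stream_alg pmf"

definition solves_connectivity_on ::
  "streaming_algorithm \<Rightarrow> nat pair_pre_digraph set \<Rightarrow> bool" where
  "solves_connectivity_on A F \<longleftrightarrow>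
     (\<forall>G\<in>F. \<forall>xs. al_stream G xs \<longrightarrow>
        measure_pmf.prob (A (num_verts G)) {D. decision D xs = graph_connected G} \<ge> 2 / 3)"

text \<open>The worst case over the coin tosses is what counts as memory usage.\<close>

definition uses_at_least_bits ::
  "streaming_algorithm \<Rightarrow> nat pair_pre_digraph \<Rightarrow> real \<Rightarrow> bool" where
  "uses_at_least_bits A G b \<longleftrightarrow>
     (\<exists>xs. al_stream G xs \<and> (\<exists>D\<in>set_pmf (A (num_verts G)). real (memory_bits D xs) \<ge> b))"

text \<open>Deterministic algorithms are the special case of point distributions.\<close>

lemma solves_connectivity_on_deterministic:
  "solves_connectivity_on (\<lambda>n. return_pmf (D n)) F \<longleftrightarrow>
     (\<forall>G\<in>F. \<forall>xs. al_stream G xs \<longrightarrow> decision (D (num_verts G)) xs = graph_connected G)"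
  by (auto simp: solves_connectivity_on_def measure_return indicator_def split: if_splits)

lemma uses_at_least_bits_deterministic:
  "uses_at_least_bits (\<lambda>n. return_pmf (D n)) G b \<longleftrightarrow>
     (\<exists>xs. al_stream G xs \<and> real (memory_bits (D (num_verts G)) xs) \<ge> b)"
  by (simp add: uses_at_least_bits_def)

end

theory Submission
  imports Defs
begin

text \<open>
  One-way communication. Alice holds a bijection \<open>\<pi>\<close> from \<open>m = 2 ^ T\<close> items to \<open>m\<close> bins, Bob an item
  \<open>x\<close> and a bit position \<open>t\<close>. She threads item \<open>i\<close> through bin \<open>\<pi> i\<close>, giving one path per bin. Bob
  closes the bins whose number has bit \<open>t\<close> clear to a cycle, joins the other bins to a path, cuts item
  \<open>x\<close> open, and ties one of the two loose ends to the start of that path. If bit \<open>t\<close> of \<open>\<pi> x\<close> is clear,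
  the cut turns the cycle into a path prolonging the other one and the graph is a single path;
  otherwise the cycle splits off. Hence the memory state after Alice's vertices answers each of the
  \<open>m * T\<close> queries with probability \<open>2/3\<close>, and since \<open>m! \<ge> 2 ^ (m * T - 2 * m)\<close>, such a state needs
  \<open>\<Omega>(m * T)\<close> bits.
\<close>

section \<open>Counting and numerical estimates\<close>

lemma sum_Pow_power_card:
  assumes "finite Q"
  shows "(\<Sum>E\<in>Pow Q. z ^ card E) = (1 + z :: real) ^ card Q"
  using prod_add[OF assms, of "\<lambda>_. z" "\<lambda>_. 1"] by (simp add: add.commute)

text \<open>2^(-e) is convex in e, so it lies above its tangent at e = \<open>a\<close>. Summed over
  all inputs, this serves as Jensen's inequality.\<close>

lemma half_power_tangent:
  "2 powr - a * (1 - (real e - a) * ln 2) \<le> (1 / 2) ^ e"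
proof -
  have "(1 / 2 :: real) ^ e = 2 powr - a * exp ((a - real e) * ln 2)"
    by (simp add: powr_def exp_add[symmetric] algebra_simps power_one_over exp_minus
        powr_realpow[symmetric] inverse_eq_divide exp_diff)
  also have "\<dots> \<ge> 2 powr - a * (1 + (a - real e) * ln 2)"
    by (intro mult_left_mono exp_ge_add_one_self) simp
  finally show ?thesis by (simp add: algebra_simps)
qed

text \<open>
  An input is determined by the memory state together with the set of wrongly answered queries;
  weighting an error set \<open>E\<close> by \<open>(1/2)^card E\<close> charges for the second component.
\<close>

lemma one_way_counting_bound:
  fixes err :: "'p \<Rightarrow> 'q set"
  assumes fin: "finite P" "finite Q" "finite W"
    and enc: "enc ` P \<subseteq> W" and err: "\<And>p. p \<in> P \<Longrightarrow> err p \<subseteq> Q"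
    and inj: "inj_on (\<lambda>p. (enc p, err p)) P"
    and avg: "(\<Sum>p\<in>P. real (card (err p))) \<le> real (card P) * real (card Q) / 3"
  shows "real (card P) * 2 powr (- real (card Q) / 3) \<le> real (card W) * (3 / 2) ^ card Q"
proof -
  define a where "a = real (card Q) / 3"
  \<comment> \<open>By \<open>avg\<close>, the first-order terms of the tangent at \<open>a\<close>
    have a nonnegative sum.\<close>
  have "real (card P) * 2 powr - a
      \<le> 2 powr - a * (real (card P) - ((\<Sum>p\<in>P. real (card (err p))) - real (card P) * a) * ln 2)"
    using avg by (simp add: a_def mult_nonpos_nonneg)
  also have "\<dots> = (\<Sum>p\<in>P. 2 powr - a * (1 - (real (card (err p)) - a) * ln 2))"
    by (simp add: sum_distrib_left[symmetric] sum_distrib_right[symmetric] sum_subtractf)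
  also have "\<dots> \<le> (\<Sum>p\<in>P. (1 / 2) ^ card (err p))"
    by (intro sum_mono half_power_tangent)
  also have "\<dots> = (\<Sum>x\<in>(\<lambda>p. (enc p, err p)) ` P. (1 / 2) ^ card (snd x))"
    by (subst sum.reindex[OF inj]) simp
  also have "\<dots> \<le> (\<Sum>x\<in>W \<times> Pow Q. (1 / 2) ^ card (snd x))"
    using fin enc err by (intro sum_mono2) auto
  also have "\<dots> = real (card W) * (3 / 2) ^ card Q"
    using sum_Pow_power_card[OF fin(2), of "1 / 2"]
      sum.cartesian_product[of "\<lambda>_ E. (1 / 2 :: real) ^ card E" "Pow Q" W]
    by (simp add: case_prod_unfold)
  finally show ?thesis by (simp add: a_def)
qed

lemma card_bool_lists_le: "card {l :: bool list. length l \<le> s} \<le> 2 ^ Suc s"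
proof -
  have "card {l :: bool list. set l \<subseteq> UNIV \<and> length l \<le> s} = (\<Sum>i\<le>s. 2 ^ i)"
    by (subst card_lists_length_le) auto
  also have "\<dots> \<le> 2 ^ Suc s"
    using sum_power2[of "Suc s"] by (simp add: lessThan_Suc_atMost[symmetric] atLeast0LessThan)
  finally show ?thesis by simp
qed

lemma finite_bool_lists_le: "finite {l :: bool list. length l \<le> s}"
  using finite_lists_length_le[of "UNIV :: bool set" s] by simp

text \<open>m^m / m! is a single term of the series for e^m. Rounding e up to 4 keeps later bounds
  in powers of two.\<close>

lemma power_self_le_four_power_fact: "real m ^ m \<le> 4 ^ m * fact m"
proof -
  have "real m ^ m / fact m \<le> exp (real m)"
    using sum_le_suminf[OF summable_exp[of "real m"], of "{m}"]
    by (simp add: exp_def divide_inverse mult.commute)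
  also have "\<dots> = exp 1 ^ m" by (simp add: exp_of_nat_mult[symmetric])
  also have "\<dots> \<le> 4 ^ m" using exp_le by (intro power_mono) auto
  finally show ?thesis by (simp add: divide_le_eq)
qed

section \<open>Undirected graphs given by oriented arcs, and their streams\<close>

lemma out_degree_eq_card_neighbours:
  "out_degree (with_proj G) v = card {w. (v, w) \<in> parcs G}"
proof -
  have "out_arcs (with_proj G) v = Pair v ` {w. (v, w) \<in> parcs G}"
    by (auto simp: out_arcs_def)
  then show ?thesis by (simp add: out_degree_def card_image inj_on_def)
qed

text \<open>Each edge is given with one orientation in mind, so that degree bounds follow from
  \<open>D\<close> and its converse being single-valued.\<close>

definition undirected :: "nat \<Rightarrow> nat rel \<Rightarrow> nat pair_pre_digraph" where
  "undirected n D = \<lparr>pverts = {..<n}, parcs = D \<union> D\<inverse>\<rparr>"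

lemma undirected_simps [simp]:
  "pverts (undirected n D) = {..<n}" "parcs (undirected n D) = D \<union> D\<inverse>"
  by (simp_all add: undirected_def)

lemma num_verts_undirected [simp]: "num_verts (undirected n D) = n"
  by (simp add: num_verts_def)

text \<open>A predicate preserved by every arc is constant along walks, so one that takes both
  values certifies disconnectedness.\<close>

lemma undirected_connectedD:
  assumes conn: "graph_connected (undirected n D)"
    and inv: "\<And>u v. (u, v) \<in> D \<Longrightarrow> P u = P v" and uv: "u < n" "v < n"
  shows "P u = P v"
proof -
  have "(u, v) \<in> rtrancl_on {..<n} ((D \<union> D\<inverse>)\<^sup>s)"
    using conn uv by (auto simp: graph_connected_def connected_conv)
  then show ?thesis
  proof (induction rule: rtrancl_on_induct)
    case (step y z)
    then have "(y, z) \<in> D \<or> (z, y) \<in> D" by (auto simp: symcl_def)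
    then have "P y = P z" using inv[of y z] inv[of z y] by metis
    with step.IH show ?case by simp
  qed simp
qed

text \<open>Reachability from \<open>u\<close> is itself preserved by the arcs; applying
  \<open>const\<close> to it makes every vertex reachable from \<open>u\<close>.\<close>

lemma undirected_connectedI:
  assumes "0 < n" and D: "D \<subseteq> {..<n} \<times> {..<n}"
    and const: "\<And>P :: nat \<Rightarrow> bool. \<And>v. (\<And>u v. (u, v) \<in> D \<Longrightarrow> P u = P v) \<Longrightarrow> v < n \<Longrightarrow> P v = P r"
  shows "graph_connected (undirected n D)"
proof -
  let ?R = "rtrancl_on {..<n} ((D \<union> D\<inverse>)\<^sup>s)"
  have "(u, v) \<in> ?R" if uv: "u < n" "v < n" for u v
  proof -
    have inv: "(u, y) \<in> ?R \<longleftrightarrow> (u, z) \<in> ?R" if "(y, z) \<in> D" for y z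
    proof -
      have "(y, z) \<in> (D \<union> D\<inverse>)\<^sup>s" "(z, y) \<in> (D \<union> D\<inverse>)\<^sup>s"
        using that by (auto simp: symcl_def)
      moreover have "y \<in> {..<n}" "z \<in> {..<n}" using that D by auto
      ultimately show ?thesis by (metis rtrancl_on_into_rtrancl_on)
    qed
    have "(u, w) \<in> ?R \<longleftrightarrow> (u, r) \<in> ?R" if "w < n" for w
      by (rule const[of "\<lambda>w. (u, w) \<in> ?R", OF inv that])
    from this[OF uv(1)] this[OF uv(2)] show ?thesis using uv(1) by simp
  qed
  moreover have "{..<n} \<noteq> {}" using \<open>0 < n\<close> by auto
  ultimately show ?thesis unfolding graph_connected_def connected_conv by simp
qed

lemma labelled_graph_undirected:
  assumes "0 < n" "D \<subseteq> {..<n} \<times> {..<n}" "irrefl D"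
  shows "labelled_graph (undirected n D)"
proof -
  have "finite D" using assms(2) by (rule finite_subset) simp
  then have "pair_graph (undirected n D)"
    using assms(2,3)
    by unfold_locales (auto simp: irrefl_def symmetric_def sym_def)
  then show ?thesis using assms(1) by (auto simp: labelled_graph_def)
qed

text \<open>Every vertex has at most one successor and one predecessor, and \<open>v\<close> has
  both, at distinct vertices.\<close>

lemma max_degree_undirected_eq_2:
  assumes D: "D \<subseteq> {..<n} \<times> {..<n}" "single_valued D" "single_valued (D\<inverse>)"
    and v: "(u, v) \<in> D" "(v, w) \<in> D" "u \<noteq> w"
  shows "max_degree (undirected n D) = 2"
proof -
  have fin: "finite (D `` {z})" "finite (D\<inverse> `` {z})" for z
    using D(1) by (auto intro!: finite_subset[of _ "{..<n}"])
  have nb: "{z'. (z, z') \<in> parcs (undirected n D)} = D `` {z} \<union> D\<inverse> `` {z}" for z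
    by auto
  have one: "card (D `` {z}) \<le> 1" "card (D\<inverse> `` {z}) \<le> 1" for z
    using D(2,3) fin[of z] by (auto simp: card_le_Suc0_iff_eq single_valued_def)
  have le: "out_degree (with_proj (undirected n D)) z \<le> 2" for z
    unfolding out_degree_eq_card_neighbours nb
    using card_Un_le[of "D `` {z}" "D\<inverse> `` {z}"] one[of z] by linarith
  have "card {u, w} \<le> card (D `` {v} \<union> D\<inverse> `` {v})"
    using v fin by (intro card_mono) auto
  then have "out_degree (with_proj (undirected n D)) v = 2"
    using v(3) le[of v] unfolding out_degree_eq_card_neighbours nb by simp
  moreover have "v < n" using v(1) D(1) by auto
  ultimately show ?thesis
    unfolding max_degree_def using le by (intro Max_eqI) (auto intro: image_eqI)
qed

text \<open>Sorting fixes the order of the neighbours, so the token depends on the neighbourhood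
  only.\<close>

definition token :: "nat rel \<Rightarrow> nat \<Rightarrow> al_token" where
  "token D v = (v, sorted_list_of_set ((D \<union> D\<inverse>) `` {v}))"

lemma al_stream_map_token:
  assumes "D \<subseteq> {..<n} \<times> {..<n}" "distinct vs" "set vs = {..<n}"
  shows "al_stream (undirected n D) (map (token D) vs)"
proof -
  have "finite ((D \<union> D\<inverse>) `` {v})" for v
    using assms(1) by (auto intro!: finite_subset[of _ "{..<n}"])
  moreover have "map fst (map (token D) vs) = vs"
    by (simp add: token_def comp_def)
  ultimately show ?thesis
    using assms(2,3) unfolding al_stream_def
    by (auto simp: token_def)
qed

lemma token_cong:
  "(D \<union> D\<inverse>) `` {v} = (D' \<union> D'\<inverse>) `` {v} \<Longrightarrow> token D v = token D' v"
  by (simp add: token_def)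

section \<open>The gadget graph and its connectivity\<close>

text \<open>
  Vertex \<open>vx c a\<close> belongs to bin \<open>a\<close> if \<open>c \<in> {0, 1, 6, 7}\<close> and to item \<open>a\<close> if \<open>c \<in> {2, 3, 4, 5}\<close>.
  With item \<open>i\<close> in bin \<open>j = \<pi> i\<close>, the path of that bin is
  \<open>vx 0 j, vx 1 j, vx 2 i, vx 3 i, vx 4 i, vx 5 i, vx 6 j, vx 7 j\<close>. Alice streams the vertices with
  \<open>c \<in> {1, 2, 5, 6}\<close>; the arcs joining her vertices to Bob's depend on neither input.
\<close>

definition vx :: "nat \<Rightarrow> nat \<Rightarrow> nat" where
  "vx c a = 8 * a + c"

lemma vx_eq_iff [simp]: "c < 8 \<Longrightarrow> d < 8 \<Longrightarrow> vx c a = vx d b \<longleftrightarrow> c = d \<and> a = b"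
  unfolding vx_def by presburger

lemma vx_less_iff [simp]: "c < 8 \<Longrightarrow> vx c a < 8 * m \<longleftrightarrow> a < m"
  unfolding vx_def by presburger

lemma le_vx_iff [simp]: "c < 8 \<Longrightarrow> 8 * m \<le> vx c a \<longleftrightarrow> m \<le> a"
  using vx_less_iff[of c a m] by (simp add: not_less[symmetric])

lemma vx_mod [simp]: "c < 8 \<Longrightarrow> vx c a mod 8 = c"
  by (simp add: vx_def)

lemma vx_div [simp]: "c < 8 \<Longrightarrow> vx c a div 8 = a"
  by (simp add: vx_def)

inductive_set cross_arcs :: "nat \<Rightarrow> nat rel" for m where
  "a < m \<Longrightarrow> (vx 0 a, vx 1 a) \<in> cross_arcs m"
| "a < m \<Longrightarrow> (vx 2 a, vx 3 a) \<in> cross_arcs m"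
| "a < m \<Longrightarrow> (vx 4 a, vx 5 a) \<in> cross_arcs m"
| "a < m \<Longrightarrow> (vx 6 a, vx 7 a) \<in> cross_arcs m"

inductive_set alice_arcs :: "nat \<Rightarrow> (nat \<Rightarrow> nat) \<Rightarrow> nat rel" for m \<pi> where
  "i < m \<Longrightarrow> (vx 1 (\<pi> i), vx 2 i) \<in> alice_arcs m \<pi>"
| "i < m \<Longrightarrow> (vx 5 i, vx 6 (\<pi> i)) \<in> alice_arcs m \<pi>"

text \<open>
  \<open>f\<close> lists the bins, those of the cycle being the first \<open>h\<close>. The vertices from \<open>8 * m\<close> on only pad the
  graph to \<open>n\<close> vertices; they form a tail at the end of the path.
\<close>

inductive_set bob_arcs :: "nat \<Rightarrow> nat \<Rightarrow> nat \<Rightarrow> (nat \<Rightarrow> nat) \<Rightarrow> nat \<Rightarrow> nat rel"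
  for n m x f h where
  "i < m \<Longrightarrow> i \<noteq> x \<Longrightarrow> (vx 3 i, vx 4 i) \<in> bob_arcs n m x f h"
| "Suc k < m \<Longrightarrow> Suc k \<noteq> h \<Longrightarrow> (vx 7 (f k), vx 0 (f (Suc k))) \<in> bob_arcs n m x f h"
| "(vx 7 (f (h - 1)), vx 0 (f 0)) \<in> bob_arcs n m x f h"
| "(vx 3 x, vx 0 (f h)) \<in> bob_arcs n m x f h"
| "8 * m < n \<Longrightarrow> (vx 7 (f (m - 1)), 8 * m) \<in> bob_arcs n m x f h"
| "8 * m \<le> k \<Longrightarrow> Suc k < n \<Longrightarrow> (k, Suc k) \<in> bob_arcs n m x f h"

text \<open>Both ends of every Alice arc lie here, and no end of a Bob arc does.\<close>

definition alice_verts :: "nat \<Rightarrow> nat set" where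
  "alice_verts m = {v. v < 8 * m \<and> v mod 8 \<in> {1, 2, 5, 6}}"

locale gadget =
  fixes n m :: nat and \<pi> :: "nat \<Rightarrow> nat" and x :: nat and f :: "nat \<Rightarrow> nat" and h :: nat
  assumes mn: "8 * m \<le> n" and pi: "\<pi> permutes {..<m}" and x: "x < m"
    and f: "bij_betw f {..<m} {..<m}" and h: "0 < h" "h < m"
begin

definition D :: "nat rel" where
  "D = cross_arcs m \<union> alice_arcs m \<pi> \<union> bob_arcs n m x f h"

lemma pi_less [simp]: "\<pi> i < m \<longleftrightarrow> i < m"
  using permutes_in_image[OF pi, of i] by simp

lemma pi_eq [simp]: "\<pi> i = \<pi> j \<longleftrightarrow> i = j"
  using permutes_inj[OF pi] by (auto dest: injD)

lemma f_less [simp]: "k < m \<Longrightarrow> f k < m"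
  using bij_betwE[OF f] by auto

lemma pi_ge [simp]: "m \<le> \<pi> i \<longleftrightarrow> m \<le> i"
  using pi_less[of i] by linarith

lemma f_not_ge [simp]: "k < m \<Longrightarrow> \<not> m \<le> f k"
  using f_less[of k] by linarith

lemma f_eq [simp]: "k < m \<Longrightarrow> l < m \<Longrightarrow> f k = f l \<longleftrightarrow> k = l"
  using bij_betw_imp_inj_on[OF f] by (auto dest: inj_onD)

lemma vx_less_n [simp]: "c < 8 \<Longrightarrow> a < m \<Longrightarrow> vx c a < n"
  using less_le_trans[OF _ mn, of "vx c a"] by simp

lemma vx_neq_pad [simp]:
  assumes "c < 8" "a < m" "8 * m \<le> k"
  shows "vx c a \<noteq> k" "k \<noteq> vx c a" "vx c a \<noteq> Suc k" "Suc k \<noteq> vx c a"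
  using assms le_vx_iff[of c m a] le_SucI[OF assms(3)] by (auto simp del: le_vx_iff)

lemma h_less [simp]: "h - Suc 0 < m" "m - Suc 0 < m" "0 < m"
  using h by auto

lemmas arcs_cases = cross_arcs.cases alice_arcs.cases bob_arcs.cases

lemma D_in_verts: "D \<subseteq> {..<n} \<times> {..<n}"
proof -
  have "u < n \<and> v < n" if "(u, v) \<in> D" for u v
    using that x h mn unfolding D_def by (elim UnE arcs_cases) simp_all
  then show ?thesis by auto
qed

lemma irrefl_D: "irrefl D"
proof -
  have "u \<noteq> v" if "(u, v) \<in> D" for u v
    using that x h unfolding D_def by (elim UnE arcs_cases) auto
  then show ?thesis by (auto simp: irrefl_def)
qed

text \<open>No two rules share a tail: \<open>Suc k \<noteq> h\<close> separates the arcs between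
  consecutive bins from the one closing the cycle, \<open>h < m\<close> separates the latter from
  the arc into the padding, and \<open>i \<noteq> x\<close> spares the cut item.\<close>

lemma single_valued_D: "single_valued D"
proof (rule single_valuedI)
  fix u v w assume "(u, v) \<in> D" "(u, w) \<in> D"
  then show "v = w"
    using x h unfolding D_def by (elim UnE arcs_cases) simp_all
qed

lemma single_valued_converse_D: "single_valued (D\<inverse>)"
proof (rule single_valuedI)
  fix u v w assume "(u, v) \<in> D\<inverse>" "(u, w) \<in> D\<inverse>"
  then have "(v, u) \<in> D" "(w, u) \<in> D" by simp_all
  then show "v = w"
    using x h unfolding D_def by (elim UnE arcs_cases) simp_all
qed

lemma D_intros:
  "a < m \<Longrightarrow> (vx 0 a, vx 1 a) \<in> D" "a < m \<Longrightarrow> (vx 2 a, vx 3 a) \<in> D"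
  "a < m \<Longrightarrow> (vx 4 a, vx 5 a) \<in> D" "a < m \<Longrightarrow> (vx 6 a, vx 7 a) \<in> D"
  "a < m \<Longrightarrow> (vx 1 (\<pi> a), vx 2 a) \<in> D" "a < m \<Longrightarrow> (vx 5 a, vx 6 (\<pi> a)) \<in> D"
  "a < m \<Longrightarrow> a \<noteq> x \<Longrightarrow> (vx 3 a, vx 4 a) \<in> D"
  "Suc k < m \<Longrightarrow> Suc k \<noteq> h \<Longrightarrow> (vx 7 (f k), vx 0 (f (Suc k))) \<in> D"
  "(vx 7 (f (h - 1)), vx 0 (f 0)) \<in> D" "(vx 3 x, vx 0 (f h)) \<in> D"
  "8 * m < n \<Longrightarrow> (vx 7 (f (m - 1)), 8 * m) \<in> D"
  "8 * m \<le> k \<Longrightarrow> Suc k < n \<Longrightarrow> (k, Suc k) \<in> D"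
  unfolding D_def One_nat_def
  by (auto intro: cross_arcs.intros[unfolded One_nat_def] alice_arcs.intros[unfolded One_nat_def]
      bob_arcs.intros[unfolded One_nat_def])

lemma labelled_graph: "labelled_graph (undirected n D)"
  using mn x by (intro labelled_graph_undirected D_in_verts irrefl_D) auto

lemma max_degree: "max_degree (undirected n D) = 2"
  using x by (intro max_degree_undirected_eq_2[of D n "vx 0 (\<pi> x)" "vx 1 (\<pi> x)" "vx 2 x"]
      D_in_verts single_valued_D single_valued_converse_D D_intros) auto

lemma disconnected:
  assumes "\<pi> x \<notin> f ` {..<h}"
  shows "\<not> graph_connected (undirected n D)"
proof
  assume conn: "graph_connected (undirected n D)"
  \<comment> \<open>\<open>P\<close> holds when the bin of \<open>v\<close> is on the cycle. The arc
    from the cut, \<open>vx 3 x\<close> to \<open>vx 0 (f h)\<close>, respects it because both of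
    its ends are off the cycle.\<close>
  define P where "P v \<longleftrightarrow> v < 8 * m \<and>
    (if v mod 8 \<in> {2, 3, 4, 5} then \<pi> (v div 8) else v div 8) \<in> f ` {..<h}" for v
  have mem: "f k \<in> f ` {..<h} \<longleftrightarrow> k < h" if "k < m" for k
    using that h by (auto simp: image_iff)
  have "P u \<longleftrightarrow> P v" if "(u, v) \<in> D" for u v
    using that x h assms unfolding D_def
    by (elim UnE arcs_cases) (auto simp: P_def mem)
  from undirected_connectedD[of n D P, OF conn this]
  have "P (vx 0 (f 0)) = P (vx 2 x)" using x by simp
  then show False using assms x h by (auto simp: P_def mem)
qed

text \<open>The cut bin \<open>f k0\<close> lies on the cycle. From \<open>vx 0 (f 0)\<close> one
  reaches the cut on one side going forward, and on the other side going backward through the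
  closing arc; the loose end \<open>vx 3 x\<close> then leads on to the remaining bins and the
  padding.\<close>

lemma connected:
  assumes "\<pi> x \<in> f ` {..<h}"
  shows "graph_connected (undirected n D)"
proof (rule undirected_connectedI)
  show "0 < n" using mn x by simp
  show "D \<subseteq> {..<n} \<times> {..<n}" by (rule D_in_verts)
  show "P v = P (vx 0 (f 0))" if inv: "\<And>u v. (u, v) \<in> D \<Longrightarrow> P u = P v" and v: "v < n"
    for P :: "nat \<Rightarrow> bool" and v
  proof -
    define p where "p = P (vx 0 (f 0))"
    obtain k0 where k0: "k0 < h" "\<pi> x = f k0" using assms by auto
    note I = D_intros[THEN inv]
    \<comment> \<open>The left half of an item hangs on the start of its bin, the right half on its
      end. This avoids the arc from \<open>vx 3 a\<close> to \<open>vx 4 a\<close>, so it covers the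
      cut item too.\<close>
    have item: "P (vx 2 a) = P (vx 3 a)" "P (vx 4 a) = P (vx 5 a)"
      "P (vx 2 a) = P (vx 0 (\<pi> a))" "P (vx 5 a) = P (vx 7 (\<pi> a))" if "a < m" for a
      using I(1-6)[of a] I(1,4)[of "\<pi> a"] that by auto
    have LR: "P (vx 7 (f k)) = P (vx 0 (f k))" if "k < m" "k \<noteq> k0" for k
    proof -
      obtain a where a: "f k = \<pi> a" using permutes_surj[OF pi] by (metis surj_def)
      have "a < m" using a that(1) by (metis f_less pi_less)
      moreover have "a \<noteq> x" using a k0 that h by auto
      ultimately show ?thesis using item[of a] I(7)[of a] a by simp
    qed
    have L1: "P (vx 0 (f k)) = p" if "k \<le> k0" for k
      using that
    proof (induction k)
      case (Suc k)
      then show ?case using LR[of k] I(8)[of k] k0 h by simp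
    qed (simp add: p_def)
    \<comment> \<open>Downward induction from the closing arc at \<open>h - 1\<close>.\<close>
    have R2: "P (vx 7 (f k)) = p" if "k0 \<le> k" "k < h" for k
    proof -
      have "k \<le> h - 1" using that by simp
      then show ?thesis
        using that(1)
      proof (induction rule: inc_induct)
        case base
        then show ?case using I(9) by (simp add: p_def)
      next
        case (step k)
        then show ?case using LR[of "Suc k"] I(8)[of k] k0 h by simp
      qed
    qed
    \<comment> \<open>The base case crosses from the cut to bin \<open>f h\<close>.\<close>
    have L3: "P (vx 0 (f k)) = p" if "h \<le> k" "k < m" for k
      using that
    proof (induction rule: dec_induct)
      case base
      then show ?case using I(10) item(1,3)[OF x] L1[of k0] k0 by simp
    next
      case (step k)
      then show ?case using LR[of k] I(8)[of k] k0 h by simp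
    qed
    have LR_f: "P (vx 0 (f k)) = p" "P (vx 7 (f k)) = p" if "k < m" for k
      using L1[of k] R2[of k] L3[of k] LR[of k] that k0 h
      by (cases "k \<le> k0"; cases "k < h"; simp; linarith)+
    have bin: "P (vx 0 j) = p" "P (vx 7 j) = p" if "j < m" for j
    proof -
      obtain k where "k < m" "j = f k"
        using bij_betw_imp_surj_on[OF f] \<open>j < m\<close> by (metis imageE lessThan_iff)
      then show "P (vx 0 j) = p" "P (vx 7 j) = p" using LR_f[of k] by simp_all
    qed
    have pad: "P k = p" if "8 * m \<le> k" "k < n" for k
      using that
    proof (induction rule: dec_induct)
      case base
      then show ?case using I(11) bin(2)[of "f (m - 1)"] by simp
    next
      case (step k)
      then show ?case using I(12)[of k] by simp
    qed
    show ?thesis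
    proof (cases "v < 8 * m")
      case True
      define a c where "a = v div 8" and "c = v mod 8"
      have vx: "v = vx c a" and "c < 8" by (simp_all add: vx_def a_def c_def)
      with True have a: "a < m" by simp
      have "c \<in> {0, 1, 2, 3, 4, 5, 6, 7}" using \<open>c < 8\<close> by auto
      then show ?thesis
        unfolding vx p_def[symmetric]
        using a item[OF a] I(1,4)[OF a] bin[OF a] bin[of "\<pi> a"] by auto
    qed (use pad v in \<open>simp add: p_def\<close>)
  qed
qed

text \<open>Alice's tokens do not mention \<open>x\<close>, \<open>f\<close> or \<open>h\<close>,
  and in the next lemma Bob's do not mention \<open>\<pi>\<close>; hence the stream is a one-way
  protocol.\<close>

lemma token_alice: "v \<in> alice_verts m \<Longrightarrow> token D v = token (cross_arcs m \<union> alice_arcs m \<pi>) v"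
  using x h unfolding D_def alice_verts_def
  by (intro token_cong) (auto elim!: bob_arcs.cases)

lemma token_bob: "v \<notin> alice_verts m \<Longrightarrow> token D v = token (cross_arcs m \<union> bob_arcs n m x f h) v"
  unfolding D_def alice_verts_def by (intro token_cong) (auto elim!: alice_arcs.cases)

end

section \<open>Fixing the coins, ordering the bins, and bounds on exponents\<close>

lemma pmf_ex_le_expectation:
  fixes g :: "'a \<Rightarrow> real"
  assumes "integrable (measure_pmf p) g" "measure_pmf.expectation p g \<le> b"
  shows "\<exists>y\<in>set_pmf p. g y \<le> b"
proof (rule ccontr)
  assume "\<not> ?thesis"
  then have "AE y in measure_pmf p. - g y < - b" by (auto simp: AE_measure_pmf_iff)
  with assms(1) have "measure_pmf.expectation p (\<lambda>y. - g y) < - b"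
    by (intro measure_pmf.expectation_less) auto
  then show False using assms(2) by simp
qed

text \<open>Supplies the bin order of the gadget, with the bins of the cycle first.\<close>

lemma ex_bij_betw_initial_segment:
  assumes "Z \<subseteq> {..<m :: nat}"
  shows "\<exists>f. bij_betw f {..<m} {..<m} \<and> f ` {..<card Z} = Z"
proof -
  define h where "h = card Z"
  have fin: "finite Z" "finite ({..<m} - Z)" using assms by (auto intro: finite_subset)
  have h: "h \<le> m" using card_mono[OF _ assms] by (simp add: h_def)
  have "card ({..<m} - Z) = card {h..<m}"
    using assms fin by (simp add: card_Diff_subset h_def)
  then obtain g2 where g2: "bij_betw g2 {h..<m} ({..<m} - Z)"
    using fin by (metis finite_atLeastLessThan finite_same_card_bij)
  have "card {..<h} = card Z" by (simp add: h_def)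
  then obtain g1 where g1: "bij_betw g1 {..<h} Z"
    using fin by (metis finite_lessThan finite_same_card_bij)
  define f where "f k = (if k < h then g1 k else g2 k)" for k
  have f1: "bij_betw f {..<h} Z"
    using g1 by (subst bij_betw_cong[of _ _ g1]) (auto simp: f_def)
  moreover have f2: "bij_betw f {h..<m} ({..<m} - Z)"
    using g2 by (subst bij_betw_cong[of _ _ g2]) (auto simp: f_def)
  ultimately have "bij_betw f ({..<h} \<union> {h..<m}) (Z \<union> ({..<m} - Z))"
    by (rule bij_betw_combine) auto
  moreover have "{..<h} \<union> {h..<m} = {..<m}" "Z \<union> ({..<m} - Z) = {..<m}"
    using h assms by auto
  ultimately show ?thesis using f1 by (auto simp: bij_betw_def h_def)
qed

lemma nat_eq_if_low_bits_eq:
  fixes a b :: nat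
  assumes "a < 2 ^ T" "b < 2 ^ T" "\<And>t. t < T \<Longrightarrow> bit a t = bit b t"
  shows "a = b"
proof -
  have "take_bit T a = take_bit T b"
    by (rule bit_eqI) (use assms(3) in \<open>auto simp: bit_take_bit_iff\<close>)
  then show ?thesis using assms(1,2) by (simp add: take_bit_nat_eq_self)
qed

text \<open>Fifth powers give 243/32 < 8. The exponent has to be below 2/3 for the final comparison
  to leave a positive rate.\<close>

lemma three_halves_le_powr: "(3 / 2 :: real) \<le> 2 powr (3 / 5)"
proof (rule power_le_imp_le_base)
  have "(2 powr (3 / 5)) ^ Suc 4 = (2 powr 3 :: real)" by (subst powr_power) simp_all
  also have "\<dots> = 2 ^ 3" using powr_realpow[of "2 :: real" 3] by simp
  finally show "(3 / 2 :: real) ^ Suc 4 \<le> (2 powr (3 / 5)) ^ Suc 4" by (simp add: power_divide)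
qed simp

lemma fact_two_power_ge: "2 powr (real (2 ^ T * T) - 2 * real (2 ^ T)) \<le> fact (2 ^ T)"
proof -
  define m where "m = (2 :: nat) ^ T"
  have "2 powr real (m * T) = (2 :: real) ^ (m * T)" by (simp only: powr_realpow zero_less_numeral)
  also have "\<dots> = real m ^ m" by (simp add: m_def power_mult[symmetric] mult.commute)
  finally have "2 powr real (m * T) = real m ^ m" .
  moreover have "2 powr (2 * real m) = (2 powr 2 :: real) ^ m" by (subst powr_power) (simp_all add: mult.commute)
  ultimately have "2 powr (real (m * T) - 2 * real m) = real m ^ m / 4 ^ m"
    using powr_realpow[of "2 :: real" 2] by (simp add: powr_diff)
  also have "\<dots> \<le> fact m"
    using power_self_le_four_power_fact[of m] by (simp add: divide_le_eq mult.commute)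
  finally show ?thesis by (simp only: m_def)
qed

section \<open>The memory bound for a fixed number of vertices\<close>

lemma memory_lower_bound:
  fixes A :: "stream_alg pmf"
  assumes T: "0 < T" and m: "m = 2 ^ T" and mn: "8 * m \<le> n"
    and correct: "\<And>G xs. labelled_graph G \<Longrightarrow> max_degree G = 2 \<Longrightarrow> num_verts G = n \<Longrightarrow> al_stream G xs
      \<Longrightarrow> measure_pmf.prob A {D. decision D xs = graph_connected G} \<ge> 2 / 3"
    and mem: "\<And>G xs D. labelled_graph G \<Longrightarrow> max_degree G = 2 \<Longrightarrow> num_verts G = n \<Longrightarrow> al_stream G xs
      \<Longrightarrow> D \<in> set_pmf A \<Longrightarrow> memory_bits D xs \<le> s"
  shows "real m * real T / 15 \<le> 2 * real m + real s + 1"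
proof -
  define P where "P = {\<pi>. \<pi> permutes {..<m}}"
  define Q where "Q = {..<m} \<times> {..<T}"
  define Z where "Z t = {j. j < m \<and> \<not> bit j t}" for t
  define h where "h t = card (Z t)" for t
  have finPQ: "finite P" "finite Q" by (simp_all add: P_def Q_def finite_permutations)
  have m2: "0 < m" by (simp add: m)
  \<comment> \<open>Among the bins, 0 has bit \<open>t\<close> clear and \<open>2 ^ t\<close> has it
    set.\<close>
  have h: "0 < h t" "h t < m" if "t < T" for t
  proof -
    have "0 \<in> Z t" "finite (Z t)" using m2 by (simp_all add: Z_def)
    then show "0 < h t" by (auto simp: h_def card_gt_0_iff)
    have "2 ^ t \<in> {..<m}" "2 ^ t \<notin> Z t"
      using that by (simp_all add: m Z_def bit_exp_iff)
    then have "Z t \<subset> {..<m}" by (auto simp: Z_def)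
    then show "h t < m" using psubset_card_mono[of "{..<m}"] by (simp add: h_def)
  qed
  \<comment> \<open>The bin order depends on \<open>t\<close> alone, so Bob can find it without
    knowing \<open>\<pi>\<close>.\<close>
  have "\<forall>t. \<exists>f. bij_betw f {..<m} {..<m} \<and> f ` {..<h t} = Z t"
    unfolding h_def by (intro allI ex_bij_betw_initial_segment) (auto simp: Z_def)
  then obtain f where f_seg: "\<And>t. bij_betw (f t) {..<m} {..<m}" "\<And>t. f t ` {..<h t} = Z t"
    by metis
  define arcs where "arcs \<pi> q = gadget.D n m \<pi> (fst q) (f (snd q)) (h (snd q))" for \<pi> q
  define alice where "alice \<pi> = map (token (cross_arcs m \<union> alice_arcs m \<pi>))
    (sorted_list_of_set (alice_verts m))" for \<pi>
  define bob where "bob q = map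
    (token (cross_arcs m \<union> bob_arcs n m (fst q) (f (snd q)) (h (snd q))))
    (sorted_list_of_set ({..<n} - alice_verts m))" for q
  have gadget: "gadget n m \<pi> (fst q) (f (snd q)) (h (snd q))" if "\<pi> \<in> P" "q \<in> Q" for \<pi> q
    using that mn f_seg(1) h by unfold_locales (auto simp: P_def Q_def)
  have graph: "labelled_graph (undirected n (arcs \<pi> q))" "max_degree (undirected n (arcs \<pi> q)) = 2"
    "graph_connected (undirected n (arcs \<pi> q)) \<longleftrightarrow> \<not> bit (\<pi> (fst q)) (snd q)"
    "al_stream (undirected n (arcs \<pi> q)) (alice \<pi> @ bob q)" if \<pi>q: "\<pi> \<in> P" "q \<in> Q" for \<pi> q
  proof -
    interpret gadget n m \<pi> "fst q" "f (snd q)" "h (snd q)" using \<pi>q by (rule gadget)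
    show "labelled_graph (undirected n (arcs \<pi> q))" "max_degree (undirected n (arcs \<pi> q)) = 2"
      unfolding arcs_def by (rule labelled_graph max_degree)+
    have "\<pi> (fst q) < m" using \<pi>q by (auto simp: Q_def)
    then show "graph_connected (undirected n (arcs \<pi> q)) \<longleftrightarrow> \<not> bit (\<pi> (fst q)) (snd q)"
      using connected disconnected f_seg(2)[of "snd q"] unfolding arcs_def Z_def by auto
    have av: "alice_verts m \<subseteq> {..<n}" using mn by (auto simp: alice_verts_def)
    then have fin: "finite (alice_verts m)" by (rule finite_subset) simp
    have "alice \<pi> @ bob q = map (token (arcs \<pi> q))
        (sorted_list_of_set (alice_verts m) @ sorted_list_of_set ({..<n} - alice_verts m))"
      using fin by (auto simp: alice_def bob_def arcs_def token_alice token_bob)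
    then show "al_stream (undirected n (arcs \<pi> q)) (alice \<pi> @ bob q)"
      using fin av by (auto simp: arcs_def simp del: map_append intro!: al_stream_map_token D_in_verts)
  qed
  define err where "err D \<pi> = {q \<in> Q. decision D (alice \<pi> @ bob q) \<noteq> (\<not> bit (\<pi> (fst q)) (snd q))}" for D \<pi>
  have prob_err: "measure_pmf.prob A {D. q \<in> err D \<pi>} \<le> 1 / 3" if \<pi>q: "\<pi> \<in> P" "q \<in> Q" for \<pi> q
  proof -
    let ?ok = "{D. decision D (alice \<pi> @ bob q) = graph_connected (undirected n (arcs \<pi> q))}"
    have "{D. q \<in> err D \<pi>} = UNIV - ?ok"
      using \<pi>q graph(3)[OF \<pi>q] by (auto simp: err_def)
    moreover have "measure_pmf.prob A ?ok \<ge> 2 / 3"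
      using graph[OF \<pi>q] by (intro correct) auto
    ultimately show ?thesis using measure_pmf.prob_compl[of ?ok A] by simp
  qed
  \<comment> \<open>\<open>g D\<close> is the number of wrong answers over all inputs and queries.
    Its mean is at most a third of the number of pairs, so some outcome in the support does no
    worse; being in the support, it also obeys the memory bound \<open>mem\<close>.\<close>
  define g where "g D = (\<Sum>\<pi>\<in>P. \<Sum>q\<in>Q. indicator {D. q \<in> err D \<pi>} D :: real)" for D
  have "\<exists>D\<in>set_pmf A. g D \<le> real (card P) * real (card Q) / 3"
  proof (rule pmf_ex_le_expectation)
    have int: "integrable (measure_pmf A) (indicator S :: _ \<Rightarrow> real)" for S
      by (rule measure_pmf.integrable_const_bound[of _ 1]) auto
    show "integrable (measure_pmf A) g"
      unfolding g_def by (intro Bochner_Integration.integrable_sum int)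
    have "measure_pmf.expectation A g = (\<Sum>\<pi>\<in>P. \<Sum>q\<in>Q. measure_pmf.prob A {D. q \<in> err D \<pi>})"
      unfolding g_def
      by (simp add: Bochner_Integration.integral_sum int)
    also have "\<dots> \<le> (\<Sum>\<pi>\<in>P. \<Sum>q\<in>Q. 1 / 3)" by (intro sum_mono prob_err)
    finally show "measure_pmf.expectation A g \<le> real (card P) * real (card Q) / 3" by simp
  qed
  then obtain D where D: "D \<in> set_pmf A" and gD: "g D \<le> real (card P) * real (card Q) / 3" ..
  have "(\<Sum>q\<in>Q. indicator {D. q \<in> err D \<pi>} D) = real (card (err D \<pi>))" for \<pi>
  proof -
    have "err D \<pi> \<subseteq> Q" by (auto simp: err_def)
    then show ?thesis using finPQ by (simp add: indicator_def Int_absorb1)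
  qed
  then have avg: "(\<Sum>\<pi>\<in>P. real (card (err D \<pi>))) \<le> real (card P) * real (card Q) / 3"
    using gD by (simp add: g_def)
  let ?W = "{l :: bool list. length l \<le> s}"
  have "run D (alice \<pi>) \<in> ?W" if "\<pi> \<in> P" for \<pi>
  proof -
    \<comment> \<open>Any query completes Alice's part to a full stream, to which \<open>mem\<close>
      applies.\<close>
    have q: "(0, 0) \<in> Q" using T m2 by (simp add: Q_def)
    have "length (run D (alice \<pi>)) \<le> memory_bits D (alice \<pi> @ bob (0, 0))"
      unfolding memory_bits_def
      by (intro Max_ge) (auto intro!: image_eqI[of _ _ "length (alice \<pi>)"])
    also have "\<dots> \<le> s" using graph[OF that q] D by (intro mem) auto
    finally show ?thesis by simp
  qed
  then have enc: "(\<lambda>\<pi>. run D (alice \<pi>)) ` P \<subseteq> ?W" by auto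
  \<comment> \<open>Equal states give equal answers to every query. Equal error sets then tell which
    answers to flip, so all bits of both permutations agree.\<close>
  have inj: "inj_on (\<lambda>\<pi>. (run D (alice \<pi>), err D \<pi>)) P"
  proof (rule inj_onI, rule ext)
    fix \<pi> \<rho> i
    assume \<pi>\<rho>: "\<pi> \<in> P" "\<rho> \<in> P" "(run D (alice \<pi>), err D \<pi>) = (run D (alice \<rho>), err D \<rho>)"
    then have same: "decision D (alice \<pi> @ bob q) = decision D (alice \<rho> @ bob q)" for q
      by (simp add: decision_def run_def)
    show "\<pi> i = \<rho> i"
    proof (cases "i < m")
      case True
      have "bit (\<pi> i) t = bit (\<rho> i) t" if "t < T" for t
      proof -
        have "(i, t) \<in> Q" using True that by (simp add: Q_def)
        moreover have "(i, t) \<in> err D \<pi> \<longleftrightarrow> (i, t) \<in> err D \<rho>" using \<pi>\<rho>(3) by simp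
        ultimately show ?thesis using same[of "(i, t)"] by (auto simp: err_def)
      qed
      moreover have "\<pi> i < 2 ^ T" "\<rho> i < 2 ^ T"
        using \<pi>\<rho>(1,2) True permutes_in_image[of _ "{..<m}" i] by (auto simp: P_def m)
      ultimately show ?thesis by (rule nat_eq_if_low_bits_eq[rotated -1])
    next
      case False
      then show ?thesis using \<pi>\<rho>(1,2) by (simp add: P_def permutes_not_in)
    qed
  qed
  have "real (card P) * 2 powr (- real (card Q) / 3) \<le> real (card ?W) * (3 / 2) ^ card Q"
    by (rule one_way_counting_bound[OF finPQ finite_bool_lists_le enc _ inj avg]) (auto simp: err_def)
  moreover have "card P = fact m" by (simp add: P_def card_permutations)
  moreover have "card Q = m * T" by (simp add: Q_def)
  ultimately have "fact m * 2 powr (- real (m * T) / 3) \<le> real (card ?W) * (3 / 2) ^ (m * T)"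
    by simp
  also have "\<dots> \<le> 2 powr (real s + 1) * 2 powr (3 / 5 * real (m * T))"
  proof (intro mult_mono)
    have "real (card ?W) \<le> real (2 ^ Suc s)" using card_bool_lists_le by (intro of_nat_mono)
    then show "real (card ?W) \<le> 2 powr (real s + 1)" by (simp add: powr_add powr_realpow)
    have "(3 / 2 :: real) ^ (m * T) \<le> (2 powr (3 / 5)) ^ (m * T)"
      by (intro power_mono three_halves_le_powr) simp
    also have "\<dots> = 2 powr (3 / 5 * real (m * T))"
      by (subst powr_power) (simp_all add: mult.commute)
    finally show "(3 / 2 :: real) ^ (m * T) \<le> 2 powr (3 / 5 * real (m * T))" .
  qed auto
  also have "\<dots> = 2 powr (real s + 1 + 3 / 5 * real (m * T))" by (simp add: powr_add)
  finally have upper: "fact m * 2 powr (- real (m * T) / 3) \<le> 2 powr (real s + 1 + 3 / 5 * real (m * T))" .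
  have "2 powr (real (m * T) - 2 * real m) * 2 powr (- real (m * T) / 3)
      \<le> fact m * 2 powr (- real (m * T) / 3)"
    unfolding m by (intro mult_right_mono fact_two_power_ge) simp
  also note upper
  \<comment> \<open>Comparing exponents leaves the rate 1 - 1/3 - 3/5 = 1/15.\<close>
  finally have "real (m * T) - 2 * real m + - real (m * T) / 3 \<le> real s + 1 + 3 / 5 * real (m * T)"
    by (subst (asm) powr_add[symmetric]) simp
  then show ?thesis by (simp add: field_simps)
qed

section \<open>Arbitrary n, by padding\<close>

theorem theorem39:
  shows "\<exists>c>0::real. \<forall>(F :: nat pair_pre_digraph set) (A :: streaming_algorithm).
           F \<subseteq> {G. labelled_graph G} \<longrightarrow>
           {G. labelled_graph G \<and> max_degree G = 2} \<subseteq> F \<longrightarrow>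
           solves_connectivity_on A F \<longrightarrow>
           (\<forall>\<^sub>F n in sequentially.
              \<exists>G\<in>F. num_verts G = n \<and> uses_at_least_bits A G (c * (real n * log 2 (real n))))"
proof (intro exI[of _ "1 / 2000"] conjI allI impI)
  fix F :: "nat pair_pre_digraph set" and A :: streaming_algorithm
  assume F: "{G. labelled_graph G \<and> max_degree G = 2} \<subseteq> F" and A: "solves_connectivity_on A F"
  show "\<forall>\<^sub>F n in sequentially.
      \<exists>G\<in>F. num_verts G = n \<and> uses_at_least_bits A G (1 / 2000 * (real n * log 2 (real n)))"
  \<comment> \<open>The threshold forces \<open>100 < T\<close>, enough to absorb the lower-order
    terms.\<close>
  proof (rule eventually_sequentiallyI[of "2 ^ 104"], rule ccontr)
    fix n :: nat
    define b where "b = 1 / 2000 * (real n * log 2 (real n))"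
    assume n: "2 ^ 104 \<le> n"
      and "\<not> (\<exists>G\<in>F. num_verts G = n \<and> uses_at_least_bits A G (1 / 2000 * (real n * log 2 (real n))))"
    then have few: "real (memory_bits D xs) < b"
      if "G \<in> F" "num_verts G = n" "al_stream G xs" "D \<in> set_pmf (A n)" for G xs D
      using that unfolding uses_at_least_bits_def b_def by (metis not_less)
    have "1 \<le> n div 8" using n by simp
    \<comment> \<open>\<open>2 ^ T\<close> is the largest power of two for which the gadget fits
      into \<open>n\<close> vertices, so fewer than half of them are padding.\<close>
    then obtain T where T: "2 ^ T \<le> n div 8" "n div 8 < 2 ^ (T + 1)"
      using ex_power_ivl1[of 2 "n div 8"] by auto
    define m where "m = (2 :: nat) ^ T"
    have mn: "8 * m \<le> n" "n < 16 * m" using T by (simp_all add: m_def)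
    have "(2 :: nat) ^ 104 < 2 ^ (T + 4)" using n mn(2) by (simp add: m_def power_add)
    then have T100: "100 < T" by (subst (asm) power_strict_increasing_iff) auto
    have "n < 2 ^ (T + 4)" using mn(2) by (simp add: m_def power_add)
    then have "log 2 (real n) < real (T + 4)"
      using n by (intro log2_of_power_less) simp_all
    moreover have "0 \<le> log 2 (real n)" "real n \<le> 16 * real m" using n mn(2) by simp_all
    ultimately have "real n * log 2 (real n) \<le> 16 * real m * (real T + 4)"
      by (intro mult_mono) auto
    \<comment> \<open>16/2000 = 1/125, well below the rate 1/15.\<close>
    then have b: "0 \<le> b" "b \<le> 1 / 125 * real m * (real T + 4)"
      using \<open>0 \<le> log 2 (real n)\<close> by (simp_all add: b_def)
    have "real m * real T / 15 \<le> 2 * real m + real (nat \<lfloor>b\<rfloor>) + 1"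
    proof (rule memory_lower_bound[where A = "A n"])
      fix G xs assume G: "labelled_graph G" "max_degree G = 2" "num_verts G = n" "al_stream G xs"
      then show "2 / 3 \<le> measure_pmf.prob (A n) {D. decision D xs = graph_connected G}"
        using A F unfolding solves_connectivity_on_def by auto
      fix D assume "D \<in> set_pmf (A n)"
      then have "real (memory_bits D xs) < b" using G F by (intro few) auto
      then show "memory_bits D xs \<le> nat \<lfloor>b\<rfloor>" by (simp add: le_nat_floor)
    qed (use T100 mn(1) m_def in simp_all)
    also have "real (nat \<lfloor>b\<rfloor>) \<le> b" using b(1) by simp
    finally have "real m * real T / 15 \<le> 2 * real m + 1 / 125 * real m * (real T + 4) + 1"
      using b(2) by simp
    moreover have "1 \<le> real m" by (simp add: m_def)
    ultimately have "real m * (real T / 15) \<le> real m * (2 + (real T + 4) / 125 + 1)"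
      by (simp add: algebra_simps)
    then have "real T / 15 \<le> 2 + (real T + 4) / 125 + 1"
      using \<open>1 \<le> real m\<close> by (subst (asm) mult_le_cancel_left_pos) auto
    moreover have "100 < real T" using T100 by simp
    ultimately show False by argo
  qed
qed simp

end
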